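(* Let $E$ be a Banach space. If $f\colon E\to E$ is Fréchet differentiable with derivative $f'\colon E\to\mathcal L(E)$ that is locally uniformly continuous and locally bounded, then the composition operator $C_f$ maps $bv_1(E)$ into itself and is locally uniformly continuous.
   Context: $E$ is a Banach space over $\mathbb R$ or $\mathbb C$ with norm $\|\cdot\|$. $\mathcal L(E)$ is the Banach space of all continuous linear operators $T\colon E\to E$ with the operator norm. For a map $f\colon E\to E$, the composition operator $C_f$ assigns to a sequence $x\colon\mathbb N\to E$ the sequence $C_f(x)$ with $C_f(x)(n)=f(x(n))$ for all $n\in\mathbb N$. $bv_1(E)$ is the space of all sequences $x\colon\mathbb N\to E$ with $\sum_{n=1}^\infty\|x(n+1)-x(n)\|<+\infty$, with norm $\|x\|_{bv_1}=\|x(1)\|+\sum_{n=1}^\infty\|x(n+1)-x(n)\|$. A map between normed spaces is called locally uniformly continuous if it is uniformly continuous on every bounded subset of its domain, and locally bounded if it is bounded on every bounded subset of its domain. *)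

theory Defs
  imports "HOL-Analysis.Analysis"
begin

text \<open>
  The type class \<^class>\<open>banach\<close> only provides real scalars. A Banach space over \<open>K\<close> is a real
  Banach space with a compatible scalar multiplication by \<open>K\<close>. The class \<^class>\<open>real_normed_field\<close>
  has \<^typ>\<open>real\<close> and \<^typ>\<open>complex\<close> as instances, and, by the Gelfand--Mazur theorem, no others up to
  isometric isomorphism.
\<close>

locale banach_space_over = vector_space smul
  for smul :: "'k::real_normed_field \<Rightarrow> 'a::banach \<Rightarrow> 'a" +
  assumes smul_of_real: "smul (of_real r) x = r *\<^sub>R x"
    and norm_smul: "norm (smul c x) = norm c * norm x"

lemma banach_space_over_scaleR: "banach_space_over (scaleR :: real \<Rightarrow> 'a::banach \<Rightarrow> 'a)"
  by unfold_locales (simp_all add: algebra_simps)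

lemma banach_space_over_mult:
  "banach_space_over ((*) :: 'k::{real_normed_field,banach} \<Rightarrow> 'k \<Rightarrow> 'k)"
  by unfold_locales (simp_all add: algebra_simps norm_mult scaleR_conv_of_real)

text \<open>
  The operator norm of a bounded linear map does not depend on the scalar field, so the space of
  bounded \<open>K\<close>-linear operators is a subspace of the real one, with the norm of \<^typ>\<open>'a \<Rightarrow>\<^sub>L 'a\<close>.
\<close>

definition bounded_operators ::
  "('k::real_normed_field \<Rightarrow> 'a::banach \<Rightarrow> 'a) \<Rightarrow> ('a \<Rightarrow>\<^sub>L 'a) set" where
  "bounded_operators smul = {T. Vector_Spaces.linear smul smul (blinfun_apply T)}"

definition has_frechet_derivative_map ::
  "('k::real_normed_field \<Rightarrow> 'a::banach \<Rightarrow> 'a) \<Rightarrow> ('a \<Rightarrow> 'a) \<Rightarrow> ('a \<Rightarrow> 'a \<Rightarrow>\<^sub>L 'a) \<Rightarrow> bool" where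
  "has_frechet_derivative_map smul f f' \<longleftrightarrow>
    (\<forall>x. f' x \<in> bounded_operators smul \<and> (f has_derivative blinfun_apply (f' x)) (at x))"

definition locally_uniformly_continuous ::
  "('a::real_normed_vector \<Rightarrow> 'b::real_normed_vector) \<Rightarrow> bool" where
  "locally_uniformly_continuous g \<longleftrightarrow> (\<forall>B. bounded B \<longrightarrow> uniformly_continuous_on B g)"

definition locally_bounded ::
  "('a::real_normed_vector \<Rightarrow> 'b::real_normed_vector) \<Rightarrow> bool" where
  "locally_bounded g \<longleftrightarrow> (\<forall>B. bounded B \<longrightarrow> bounded (g ` B))"

text \<open>Sequences are indexed from 0, so the first term is \<open>x 0\<close>.\<close>

definition bv1_seqs :: "(nat \<Rightarrow> 'a::real_normed_vector) set" where
  "bv1_seqs = {x. summable (\<lambda>n. norm (x (Suc n) - x n))}"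

typedef (overloaded) ('a::real_normed_vector) bv1 = "bv1_seqs :: (nat \<Rightarrow> 'a) set"
  morphisms bv1_seq Bv1
proof
  show "(\<lambda>_. 0) \<in> bv1_seqs" by (simp add: bv1_seqs_def)
qed

setup_lifting type_definition_bv1

lemma bv1_seqs_add:
  assumes "x \<in> bv1_seqs" "y \<in> bv1_seqs"
  shows "(\<lambda>n. x n + y n) \<in> bv1_seqs"
proof -
  have "summable (\<lambda>n. norm (x (Suc n) - x n) + norm (y (Suc n) - y n))"
    using assms by (simp add: bv1_seqs_def summable_add)
  moreover have "norm (x (Suc n) + y (Suc n) - (x n + y n))
      \<le> norm (x (Suc n) - x n) + norm (y (Suc n) - y n)" for n
    by (simp add: add_diff_add norm_triangle_ineq)
  ultimately show ?thesis
    unfolding bv1_seqs_def by (auto intro: summable_comparison_test')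
qed

lemma bv1_seqs_scaleR:
  assumes "x \<in> bv1_seqs"
  shows "(\<lambda>n. r *\<^sub>R x n) \<in> bv1_seqs"
  using assms by (simp add: bv1_seqs_def summable_mult flip: scaleR_diff_right)

lemma bv1_seqs_minus:
  assumes "x \<in> bv1_seqs"
  shows "(\<lambda>n. - x n) \<in> bv1_seqs"
  using bv1_seqs_scaleR[OF assms, of "-1"] by simp

lemma bv1_seqs_diff:
  assumes "x \<in> bv1_seqs" "y \<in> bv1_seqs"
  shows "(\<lambda>n. x n - y n) \<in> bv1_seqs"
  using bv1_seqs_add[OF assms(1) bv1_seqs_minus[OF assms(2)]] by simp

instantiation bv1 :: (real_normed_vector) real_normed_vector
begin

lift_definition zero_bv1 :: "'a bv1" is "\<lambda>_. 0"
  by (simp add: bv1_seqs_def)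

lift_definition plus_bv1 :: "'a bv1 \<Rightarrow> 'a bv1 \<Rightarrow> 'a bv1" is "\<lambda>x y n. x n + y n"
  by (rule bv1_seqs_add)

lift_definition uminus_bv1 :: "'a bv1 \<Rightarrow> 'a bv1" is "\<lambda>x n. - x n"
  by (rule bv1_seqs_minus)

lift_definition minus_bv1 :: "'a bv1 \<Rightarrow> 'a bv1 \<Rightarrow> 'a bv1" is "\<lambda>x y n. x n - y n"
  by (rule bv1_seqs_diff)

lift_definition scaleR_bv1 :: "real \<Rightarrow> 'a bv1 \<Rightarrow> 'a bv1" is "\<lambda>r x n. r *\<^sub>R x n"
  by (rule bv1_seqs_scaleR)

lift_definition norm_bv1 :: "'a bv1 \<Rightarrow> real" is
  "\<lambda>x. norm (x 0) + (\<Sum>n. norm (x (Suc n) - x n))" .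

definition sgn_bv1 :: "'a bv1 \<Rightarrow> 'a bv1" where
  "sgn_bv1 x = inverse (norm x) *\<^sub>R x"

definition dist_bv1 :: "'a bv1 \<Rightarrow> 'a bv1 \<Rightarrow> real" where
  "dist_bv1 x y = norm (x - y)"

definition uniformity_bv1 :: "('a bv1 \<times> 'a bv1) filter" where
  "uniformity_bv1 = (INF e\<in>{0<..}. principal {(x, y). dist x y < e})"

definition open_bv1 :: "'a bv1 set \<Rightarrow> bool" where
  "open_bv1 U \<longleftrightarrow> (\<forall>x\<in>U. eventually (\<lambda>(x', y). x' = x \<longrightarrow> y \<in> U) uniformity)"

instance
proof
  fix x y z :: "'a bv1" and r s :: real
  show "x + y + z = x + (y + z)" "x + y = y + x" "0 + x = x" "- x + x = 0" "x - y = x + - y"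
    by (transfer; simp add: algebra_simps)+
  show "r *\<^sub>R (x + y) = r *\<^sub>R x + r *\<^sub>R y" "(r + s) *\<^sub>R x = r *\<^sub>R x + s *\<^sub>R x"
    "r *\<^sub>R s *\<^sub>R x = (r * s) *\<^sub>R x" "1 *\<^sub>R x = x"
    by (transfer; simp add: algebra_simps)+
  show "dist x y = norm (x - y)" by (rule dist_bv1_def)
  show "sgn x = inverse (norm x) *\<^sub>R x" by (rule sgn_bv1_def)
  show "uniformity = (INF e\<in>{0<..}. principal {(x :: 'a bv1, y). dist x y < e})"
    by (rule uniformity_bv1_def)
  show "open U \<longleftrightarrow> (\<forall>x\<in>U. eventually (\<lambda>(x', y). x' = x \<longrightarrow> y \<in> U) uniformity)"
    for U :: "'a bv1 set"
    by (rule open_bv1_def)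
  show "norm x = 0 \<longleftrightarrow> x = 0"
  proof transfer
    fix x :: "nat \<Rightarrow> 'a"
    assume "x \<in> bv1_seqs"
    then have s: "summable (\<lambda>n. norm (x (Suc n) - x n))" by (simp add: bv1_seqs_def)
    show "norm (x 0) + (\<Sum>n. norm (x (Suc n) - x n)) = 0 \<longleftrightarrow> x = (\<lambda>_. 0)"
    proof
      assume "norm (x 0) + (\<Sum>n. norm (x (Suc n) - x n)) = 0"
      then have "x 0 = 0" and "(\<Sum>n. norm (x (Suc n) - x n)) = 0"
        using suminf_nonneg[OF s] by (simp_all add: add_nonneg_eq_0_iff)
      then have "x (Suc n) = x n" for n
        using suminf_eq_zero_iff[OF s] by simp
      then have "x n = 0" for n
        using \<open>x 0 = 0\<close> by (induction n) simp_all
      then show "x = (\<lambda>_. 0)" by auto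
    qed simp
  qed
  show "norm (x + y) \<le> norm x + norm y"
  proof transfer
    fix x y :: "nat \<Rightarrow> 'a"
    assume xy: "x \<in> bv1_seqs" "y \<in> bv1_seqs"
    then have s: "summable (\<lambda>n. norm (x (Suc n) - x n))" "summable (\<lambda>n. norm (y (Suc n) - y n))"
      by (simp_all add: bv1_seqs_def)
    have "(\<Sum>n. norm (x (Suc n) + y (Suc n) - (x n + y n)))
        \<le> (\<Sum>n. norm (x (Suc n) - x n) + norm (y (Suc n) - y n))"
    proof (rule suminf_le)
      show "norm (x (Suc n) + y (Suc n) - (x n + y n))
          \<le> norm (x (Suc n) - x n) + norm (y (Suc n) - y n)" for n
        by (simp add: add_diff_add norm_triangle_ineq)
      show "summable (\<lambda>n. norm (x (Suc n) + y (Suc n) - (x n + y n)))"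
        using bv1_seqs_add[OF xy] by (simp add: bv1_seqs_def)
      show "summable (\<lambda>n. norm (x (Suc n) - x n) + norm (y (Suc n) - y n))"
        using s by (rule summable_add)
    qed
    also have "\<dots> = (\<Sum>n. norm (x (Suc n) - x n)) + (\<Sum>n. norm (y (Suc n) - y n))"
      using s by (rule suminf_add[symmetric])
    finally show "norm (x 0 + y 0) + (\<Sum>n. norm (x (Suc n) + y (Suc n) - (x n + y n)))
        \<le> norm (x 0) + (\<Sum>n. norm (x (Suc n) - x n))
          + (norm (y 0) + (\<Sum>n. norm (y (Suc n) - y n)))"
      using norm_triangle_ineq[of "x 0" "y 0"] by linarith
  qed
  show "norm (r *\<^sub>R x) = \<bar>r\<bar> * norm x"
  proof transfer
    fix r and x :: "nat \<Rightarrow> 'a"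
    assume "x \<in> bv1_seqs"
    then show "norm (r *\<^sub>R x 0) + (\<Sum>n. norm (r *\<^sub>R x (Suc n) - r *\<^sub>R x n))
        = \<bar>r\<bar> * (norm (x 0) + (\<Sum>n. norm (x (Suc n) - x n)))"
      by (simp add: bv1_seqs_def suminf_mult distrib_left flip: scaleR_diff_right)
  qed
qed

end

definition composition_operator :: "('a \<Rightarrow> 'a) \<Rightarrow> (nat \<Rightarrow> 'a) \<Rightarrow> (nat \<Rightarrow> 'a)" where
  "composition_operator f x = (\<lambda>n. f (x n))"

text \<open>
  The composition operator as a self-map of the normed space \<^typ>\<open>'a bv1\<close>; \<^const>\<open>Bv1\<close> is
  unspecified outside \<^const>\<open>bv1_seqs\<close>, so this is meaningful only together with the invariance
  of \<^const>\<open>bv1_seqs\<close> under the composition operator.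
\<close>

definition composition_operator_bv1 ::
  "('a::real_normed_vector \<Rightarrow> 'a) \<Rightarrow> 'a bv1 \<Rightarrow> 'a bv1" where
  "composition_operator_bv1 f x = Bv1 (composition_operator f (bv1_seq x))"

end

theory Submission
  imports Defs
begin

text \<open>
  On a ball \<open>cball 0 R\<close> let \<open>M\<close> bound \<open>f'\<close>. If \<open>u = a' - a\<close> and \<open>v = b' - b\<close>, the curve
  \<open>t \<mapsto> f (a + t u) - f (b + t v)\<close> has derivative
  \<open>(f' (a + t u) - f' (b + t v)) u + f' (b + t v) (u - v)\<close>, so by the mean value inequality
  its increment \<open>(f a' - f a) - (f b' - f b)\<close> is at most \<open>e \<parallel>u\<parallel> + M \<parallel>u - v\<parallel>\<close> once the
  segments are close enough for \<open>f'\<close> to vary by at most \<open>e\<close> between them. Applied to consecutive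
  terms of two sequences of norm at most \<open>R\<close> and summed, this bounds the distance of the images
  by \<open>e R + 2 M \<parallel>x - y\<parallel>\<close>.
\<close>

text \<open>Every bounded set lies in a ball around 0, so one modulus per radius suffices.\<close>

lemma locally_uniformly_continuousI:
  fixes g :: "'a::real_normed_vector \<Rightarrow> 'b::real_normed_vector"
  assumes "\<And>R e. R > 0 \<Longrightarrow> e > 0 \<Longrightarrow>
    \<exists>d>0. \<forall>x y. norm x \<le> R \<longrightarrow> norm y \<le> R \<longrightarrow> dist x y < d \<longrightarrow> dist (g x) (g y) < e"
  shows "locally_uniformly_continuous g"
  unfolding locally_uniformly_continuous_def uniformly_continuous_on_def
proof (intro allI impI)
  fix B :: "'a set" and e :: real
  assume "bounded B" "e > 0"
  then obtain R where "R > 0" "\<forall>x\<in>B. norm x \<le> R"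
    by (auto simp: bounded_pos)
  with assms[OF this(1) \<open>e > 0\<close>]
  show "\<exists>d>0. \<forall>x\<in>B. \<forall>x'\<in>B. dist x' x < d \<longrightarrow> dist (g x') (g x) < e"
    by meson
qed

lemma bv1_seq_summable: "summable (\<lambda>n. norm (bv1_seq x (Suc n) - bv1_seq x n))"
  using bv1_seq[of x] by (simp add: bv1_seqs_def)

text \<open>Telescoping from the first term. Thus a ball of \<open>bv1\<close> sends all terms into
  one ball of the space, and closeness in \<open>bv1\<close> is closeness of terms uniformly in
  \<open>n\<close>.\<close>

lemma norm_bv1_seq_le: "norm (bv1_seq x n) \<le> norm x"
proof -
  have "bv1_seq x n - bv1_seq x 0 = (\<Sum>k<n. bv1_seq x (Suc k) - bv1_seq x k)"
    by (simp add: sum_lessThan_telescope)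
  also have "norm \<dots> \<le> (\<Sum>k<n. norm (bv1_seq x (Suc k) - bv1_seq x k))"
    by (rule norm_sum)
  also have "\<dots> \<le> (\<Sum>k. norm (bv1_seq x (Suc k) - bv1_seq x k))"
    by (rule sum_le_suminf[OF bv1_seq_summable]) auto
  finally have "norm (bv1_seq x n - bv1_seq x 0) \<le> \<dots>" .
  then show ?thesis
    using norm_triangle_sub[of "bv1_seq x n" "bv1_seq x 0"] by (simp add: norm_bv1.rep_eq)
qed

lemma suminf_bv1_seq_le: "(\<Sum>n. norm (bv1_seq x (Suc n) - bv1_seq x n)) \<le> norm x"
  by (simp add: norm_bv1.rep_eq)

text \<open>Increments grow at most by the factor \<open>L\<close>. Asking for this only on the
  range lets a map that is Lipschitz merely on balls qualify.\<close>

lemma bv1_seqs_image_lipschitz: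
  assumes "x \<in> bv1_seqs" and "L-lipschitz_on (range x) f"
  shows "composition_operator f x \<in> bv1_seqs"
proof -
  have "summable (\<lambda>n. norm (f (x (Suc n)) - f (x n)))"
  proof (rule summable_comparison_test'[where N = 0])
    show "summable (\<lambda>n. L * norm (x (Suc n) - x n))"
      using assms(1) by (simp add: bv1_seqs_def summable_mult)
    show "norm (norm (f (x (Suc n)) - f (x n))) \<le> L * norm (x (Suc n) - x n)" for n
      using lipschitz_onD[OF assms(2), of "x (Suc n)" "x n"] by (simp add: dist_norm)
  qed
  then show ?thesis
    by (simp add: bv1_seqs_def composition_operator_def)
qed

text \<open>The splitting is asymmetric: the variation of \<open>f'\<close> is paired with the
  increment of \<open>a\<close>, so the bound \<open>M\<close> is required only along the segment
  from \<open>b\<close> to \<open>b'\<close>.\<close>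

lemma norm_diff_increments_le:
  fixes f :: "'a::real_normed_vector \<Rightarrow> 'b::real_normed_vector" and f' :: "'a \<Rightarrow> 'a \<Rightarrow>\<^sub>L 'b"
  assumes der: "\<And>x. (f has_derivative blinfun_apply (f' x)) (at x)"
    and bd: "\<And>t. t \<in> {0..1} \<Longrightarrow> norm (f' (b + t *\<^sub>R (b' - b))) \<le> M"
    and var: "\<And>t. t \<in> {0..1} \<Longrightarrow>
      norm (f' (a + t *\<^sub>R (a' - a)) - f' (b + t *\<^sub>R (b' - b))) \<le> e"
  shows "norm ((f a' - f a) - (f b' - f b)) \<le> e * norm (a' - a) + M * norm ((a' - a) - (b' - b))"
proof -
  define u v where "u = a' - a" and "v = b' - b"
  define w where "w t = f' (a + t *\<^sub>R u) u - f' (b + t *\<^sub>R v) v" for t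
  have *: "((\<lambda>t. f (a + t *\<^sub>R u)) has_derivative (\<lambda>h. h *\<^sub>R f' (a + t *\<^sub>R u) u)) (at t within {0..1})"
    for a u t
  proof -
    have "((\<lambda>t. a + t *\<^sub>R u) has_derivative (\<lambda>h. h *\<^sub>R u)) (at t within {0..1})"
      by (auto intro!: derivative_eq_intros)
    from has_derivative_compose[OF this der] show ?thesis
      by (simp add: blinfun.scaleR_right)
  qed
  have "norm ((\<lambda>t. f (a + t *\<^sub>R u) - f (b + t *\<^sub>R v)) 1 - (\<lambda>t. f (a + t *\<^sub>R u) - f (b + t *\<^sub>R v)) 0)
      \<le> (e * norm u + M * norm (u - v)) * norm (1 - 0 :: real)"
  proof (rule differentiable_bound[where S = "{0..1}" and f' = "\<lambda>t h. h *\<^sub>R w t"])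
    fix t :: real
    assume t: "t \<in> {0..1}"
    show "((\<lambda>t. f (a + t *\<^sub>R u) - f (b + t *\<^sub>R v)) has_derivative (\<lambda>h. h *\<^sub>R w t)) (at t within {0..1})"
      using has_derivative_diff[OF *[of a u t] *[of b v t]]
      by (simp add: w_def scaleR_diff_right)
    have "w t = (f' (a + t *\<^sub>R u) - f' (b + t *\<^sub>R v)) u + f' (b + t *\<^sub>R v) (u - v)"
      by (simp add: w_def blinfun.diff_left blinfun.diff_right)
    also have "norm \<dots> \<le> norm (f' (a + t *\<^sub>R u) - f' (b + t *\<^sub>R v)) * norm u
        + norm (f' (b + t *\<^sub>R v)) * norm (u - v)"
      by (intro norm_triangle_mono norm_blinfun)
    also have "\<dots> \<le> e * norm u + M * norm (u - v)"
      using bd[OF t] var[OF t] by (intro add_mono mult_right_mono) (auto simp: u_def v_def)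
    finally have "norm (w t) \<le> e * norm u + M * norm (u - v)" .
    \<comment> \<open>The derivative of a curve acts on real \<open>h\<close> by scaling
      \<open>w t\<close>, so its operator norm is at most \<open>norm (w t)\<close>.\<close>
    then show "onorm (\<lambda>h. h *\<^sub>R w t) \<le> e * norm u + M * norm (u - v)"
      by (intro onorm_le) (metis abs_ge_zero mult.commute mult_right_mono norm_scaleR real_norm_def)
  qed auto
  then show ?thesis
    by (simp add: u_def v_def algebra_simps)
qed

lemma mem_cball_segment:
  fixes a :: "'a::real_normed_vector"
  assumes "a \<in> cball c r" "a' \<in> cball c r" "t \<in> {0..1}"
  shows "a + t *\<^sub>R (a' - a) \<in> cball c r"
proof -
  have "a + t *\<^sub>R (a' - a) = (1 - t) *\<^sub>R a + t *\<^sub>R a'"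
    by (simp add: algebra_simps)
  then show ?thesis
    using convexD[OF convex_cball assms(1,2), of "1 - t" t] assms(3) by simp
qed

text \<open>Points at the same parameter differ by a convex combination of the endpoint differences,
  and balls are convex.\<close>

lemma norm_diff_segment_less:
  fixes a :: "'a::real_normed_vector"
  assumes "norm (a - b) < d" "norm (a' - b') < d" "t \<in> {0..1}"
  shows "norm ((a + t *\<^sub>R (a' - a)) - (b + t *\<^sub>R (b' - b))) < d"
proof -
  have "(a + t *\<^sub>R (a' - a)) - (b + t *\<^sub>R (b' - b)) = (1 - t) *\<^sub>R (a - b) + t *\<^sub>R (a' - b')"
    by (simp add: algebra_simps)
  then show ?thesis
    using convexD[OF convex_ball, of "a - b" 0 d "a' - b'" "1 - t" t] assms by simp
qed

text \<open>The mean value inequality, available because the ball is convex.\<close>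

lemma lipschitz_on_cball_blinfun:
  fixes f' :: "'a::real_normed_vector \<Rightarrow> 'a \<Rightarrow>\<^sub>L 'b::real_normed_vector"
  assumes "\<And>x. (f has_derivative blinfun_apply (f' x)) (at x)"
    and "M \<ge> 0" and "\<And>x. x \<in> cball c R \<Longrightarrow> norm (f' x) \<le> M"
  shows "M-lipschitz_on (cball c R) f"
  using assms
  by (intro bounded_derivative_imp_lipschitz[where f' = "\<lambda>x. blinfun_apply (f' x)"])
    (auto intro: has_derivative_at_withinI simp: norm_blinfun.rep_eq)

theorem theorem17:
  fixes smul :: "'k::real_normed_field \<Rightarrow> 'a::banach \<Rightarrow> 'a"
    and f :: "'a \<Rightarrow> 'a"
    and f' :: "'a \<Rightarrow> 'a \<Rightarrow>\<^sub>L 'a"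
  assumes "banach_space_over smul"
    and "has_frechet_derivative_map smul f f'"
    and "locally_uniformly_continuous f'"
    and "locally_bounded f'"
  shows "composition_operator f ` bv1_seqs \<subseteq> bv1_seqs \<and>
    locally_uniformly_continuous (composition_operator_bv1 f)"
proof -
  have der: "\<And>x. (f has_derivative blinfun_apply (f' x)) (at x)"
    using assms(2) by (simp add: has_frechet_derivative_map_def)
  have bound: "\<exists>M>0. \<forall>x\<in>cball 0 R. norm (f' x) \<le> M" for R
  proof -
    have "bounded (f' ` cball 0 R)"
      using assms(4) by (simp add: locally_bounded_def)
    then show ?thesis
      by (simp add: bounded_pos)
  qed
  have lip: "\<exists>M>0. (\<forall>x\<in>cball 0 R. norm (f' x) \<le> M) \<and> M-lipschitz_on (cball 0 R) f" for R
    using bound[of R] lipschitz_on_cball_blinfun[OF der] by (meson less_imp_le)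
  \<comment> \<open>The Lipschitz constant may depend on \<open>x\<close>: the whole sequence stays
    in the ball of radius \<open>norm x\<close>.\<close>
  have inv: "composition_operator f (bv1_seq x) \<in> bv1_seqs" for x
  proof -
    obtain M where "M-lipschitz_on (cball 0 (norm x)) f"
      using lip by blast
    then have "M-lipschitz_on (range (bv1_seq x)) f"
      by (rule lipschitz_on_subset) (auto simp: norm_bv1_seq_le)
    then show ?thesis
      by (rule bv1_seqs_image_lipschitz[OF bv1_seq])
  qed
  \<comment> \<open>Invariance is what allows \<open>Bv1\<close> to be inverted here.\<close>
  then have seq: "bv1_seq (composition_operator_bv1 f x) n = f (bv1_seq x n)" for x n
    by (simp add: composition_operator_bv1_def Bv1_inverse) (simp add: composition_operator_def)
  have "locally_uniformly_continuous (composition_operator_bv1 f)"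
  proof (rule locally_uniformly_continuousI)
    fix R e :: real
    assume "R > 0" "e > 0"
    obtain M where "M > 0" and M: "\<And>x. x \<in> cball 0 R \<Longrightarrow> norm (f' x) \<le> M"
      and L: "M-lipschitz_on (cball 0 R) f"
      using lip by blast
    \<comment> \<open>The total variation of \<open>x\<close> is at most \<open>R\<close>, so the
      \<open>e'\<close> terms add up to at most \<open>e / 2\<close>.\<close>
    define e' where "e' = e / (2 * R)"
    have "e' > 0"
      using \<open>e > 0\<close> \<open>R > 0\<close> by (simp add: e'_def)
    have "uniformly_continuous_on (cball 0 R) f'"
      using assms(3) by (simp add: locally_uniformly_continuous_def)
    then obtain d where "d > 0"
      and d: "\<And>x y. x \<in> cball 0 R \<Longrightarrow> y \<in> cball 0 R \<Longrightarrow> norm (x - y) < d \<Longrightarrow> norm (f' x - f' y) < e'"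
      using \<open>e' > 0\<close> unfolding uniformly_continuous_on_def dist_norm by metis
    \<comment> \<open>The quantity \<open>M * norm (x - y)\<close> will occur twice, once from the
      increments and once from the first term; \<open>e / (4 * M)\<close> keeps each below
      \<open>e / 4\<close>.\<close>
    have "dist (composition_operator_bv1 f x) (composition_operator_bv1 f y) < e"
      if xR: "norm x \<le> R" and yR: "norm y \<le> R" and xy: "dist x y < min d (e / (4 * M))" for x y
    proof -
      let ?x = "bv1_seq x" and ?y = "bv1_seq y" and ?z = "bv1_seq (x - y)"
      let ?F = "composition_operator_bv1 f x - composition_operator_bv1 f y"
      have mem: "?x n \<in> cball 0 R" "?y n \<in> cball 0 R" for n
        using norm_bv1_seq_le[of x n] norm_bv1_seq_le[of y n] xR yR by auto
      have z: "?z n = ?x n - ?y n" for n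
        by (simp add: minus_bv1.rep_eq)
      have close: "norm (?x n - ?y n) < d" for n
        using norm_bv1_seq_le[of "x - y" n] xy by (simp add: z dist_norm)
      have F: "bv1_seq ?F n = f (?x n) - f (?y n)" for n
        by (simp add: minus_bv1.rep_eq seq)
      have step: "norm (bv1_seq ?F (Suc n) - bv1_seq ?F n)
          \<le> e' * norm (?x (Suc n) - ?x n) + M * norm (?z (Suc n) - ?z n)" for n
      proof -
        have "norm ((f (?x (Suc n)) - f (?x n)) - (f (?y (Suc n)) - f (?y n)))
            \<le> e' * norm (?x (Suc n) - ?x n)
              + M * norm ((?x (Suc n) - ?x n) - (?y (Suc n) - ?y n))"
          \<comment> \<open>Both segments stay in the ball, and points at equal parameters are
            within \<open>d\<close>, so the choice of \<open>d\<close> bounds the variation of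
            \<open>f'\<close> by \<open>e'\<close>.\<close>
          by (intro norm_diff_increments_le[OF der] M less_imp_le[OF d] mem_cball_segment
              norm_diff_segment_less mem close)
        then show ?thesis
          by (simp add: F z algebra_simps)
      qed
      have sx: "summable (\<lambda>n. e' * norm (?x (Suc n) - ?x n))"
        and sz: "summable (\<lambda>n. M * norm (?z (Suc n) - ?z n))"
        by (intro summable_mult bv1_seq_summable)+
      have "(\<Sum>n. norm (bv1_seq ?F (Suc n) - bv1_seq ?F n))
          \<le> (\<Sum>n. e' * norm (?x (Suc n) - ?x n) + M * norm (?z (Suc n) - ?z n))"
        by (intro suminf_le step bv1_seq_summable summable_add sx sz)
      also have "\<dots> = e' * (\<Sum>n. norm (?x (Suc n) - ?x n)) + M * (\<Sum>n. norm (?z (Suc n) - ?z n))"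
        by (simp add: suminf_add[OF sx sz, symmetric] suminf_mult bv1_seq_summable)
      also have "\<dots> \<le> e' * R + M * norm (x - y)"
        using suminf_bv1_seq_le[of x] suminf_bv1_seq_le[of "x - y"] xR \<open>e' > 0\<close> \<open>M > 0\<close>
        by (intro add_mono mult_left_mono) auto
      finally have "(\<Sum>n. norm (bv1_seq ?F (Suc n) - bv1_seq ?F n)) \<le> e' * R + M * norm (x - y)" .
      \<comment> \<open>The increments do not see the first term, which the Lipschitz bound on the
        ball controls.\<close>
      moreover have "norm (bv1_seq ?F 0) \<le> M * norm (x - y)"
      proof -
        have "norm (bv1_seq ?F 0) \<le> M * norm (?z 0)"
          using lipschitz_onD[OF L mem(1) mem(2), of 0 0] by (simp add: F z dist_norm)
        also have "\<dots> \<le> M * norm (x - y)"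
          using \<open>M > 0\<close> by (intro mult_left_mono norm_bv1_seq_le) simp
        finally show ?thesis .
      qed
      ultimately have "norm ?F \<le> e' * R + 2 * (M * norm (x - y))"
        by (simp add: norm_bv1.rep_eq[of ?F])
      also have "e' * R = e / 2"
        using \<open>R > 0\<close> by (simp add: e'_def)
      also have "M * norm (x - y) < e / 4"
        using xy \<open>M > 0\<close> by (simp add: dist_norm field_simps)
      finally show ?thesis
        by (simp add: dist_norm)
    qed
    moreover have "min d (e / (4 * M)) > 0"
      using \<open>d > 0\<close> \<open>e > 0\<close> \<open>M > 0\<close> by simp
    ultimately show "\<exists>d>0. \<forall>x y. norm x \<le> R \<longrightarrow> norm y \<le> R \<longrightarrow> dist x y < d \<longrightarrow>
        dist (composition_operator_bv1 f x) (composition_operator_bv1 f y) < e"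
      by blast
  qed
  \<comment> \<open>Each member of \<open>bv1_seqs\<close> is \<open>bv1_seq\<close> of its image
    under \<open>Bv1\<close>, so \<open>inv\<close> covers it.\<close>
  moreover have "composition_operator f ` bv1_seqs \<subseteq> bv1_seqs"
    using inv by (metis Bv1_inverse image_subsetI)
  ultimately show ?thesis
    by blast
qed

end
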